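(* Let $x_0\in\mathbb{R}$. Let $\beta\in C^\infty(\mathbb{R})$, $\beta>0$, be such that $\beta'\ge0$ on $[x_0,\infty)$ and $\beta'(x_0)=0$. Let $(\theta,\rho)$ be the global solution of the flow (F) with admissible initial datum $(\theta_0,\rho_0)$. If $\rho_0\ge x_0$ on $[0,L]$, then $\rho\ge x_0$ on $(0,\infty)\times[0,L]$.
   Context: Fixed parameters: $L>0$, $\nu\in\mathbb{R}$, $\mu>0$, $\omega\in\mathbb{Z}$, $c_0\in\mathbb{R}$, and $\beta\in C^\infty(\mathbb{R})$ with $\beta>0$ (standing assumption). A function $\theta:[0,L]\to\mathbb{R}$ is the inclination angle of a planar arc-length parametrized curve; $\rho:[0,L]\to\mathbb{R}$ is a density. The flow (F) is the initial boundary value problem $$\partial_t\theta=\partial_s\big(\beta(\rho)(\partial_s\theta-c_0)\big)+\lambda_{\theta1}\sin\theta-\lambda_{\theta2}\cos\theta,\qquad \partial_t\rho=\mu\,\partial_s^2\rho-\tfrac12\beta'(\rho)(\partial_s\theta-c_0)^2-\lambda_\rho$$ on $(0,T)\times[0,L]$, with boundary conditions $\theta(\cdot,L)-\theta(\cdot,0)=2\pi\omega$, $\rho(\cdot,L)=\rho(\cdot,0)$, $\partial_s\theta(\cdot,L)=\partial_s\theta(\cdot,0)$, $\partial_s\rho(\cdot,L)=\partial_s\rho(\cdot,0)$, and initial condition $(\theta,\rho)(0,\cdot)=(\theta_0,\rho_0)$. The nonlocal multipliers are $$\begin{pmatrix}\lambda_{\theta1}\\ \lambda_{\theta2}\end{pmatrix}(t)=\Pi^{-1}(\theta)\int_0^L\begin{pmatrix}\cos\theta\\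 \sin\theta\end{pmatrix}\partial_s\theta\,\beta(\rho)(\partial_s\theta-c_0)\,\mathrm{d}s,\quad \Pi(\theta)=\begin{pmatrix}\int_0^L\sin^2\theta\,\mathrm{d}s&-\int_0^L\cos\theta\sin\theta\,\mathrm{d}s\\-\int_0^L\cos\theta\sin\theta\,\mathrm{d}s&\int_0^L\cos^2\theta\,\mathrm{d}s\end{pmatrix},$$ $\lambda_\rho(t)=-\frac1{2L}\int_0^L\beta'(\rho)(\partial_s\theta-c_0)^2\,\mathrm{d}s$. An admissible initial datum is $(\theta_0,\rho_0)\in C^\infty([0,L])$ with $\int_0^L\rho_0\,\mathrm{d}s=\nu L$, $\int_0^L\sin\theta_0\,\mathrm{d}s=\int_0^L\cos\theta_0\,\mathrm{d}s=0$, $\theta_0(L)-\theta_0(0)=2\pi\omega$, $\rho_0(L)=\rho_0(0)$, and $\partial_s^j\theta_0(L)=\partial_s^j\theta_0(0)$, $\partial_s^j\rho_0(L)=\partial_s^j\rho_0(0)$ for $j=1,2$. By earlier work, for each admissible initial datum (F) has a unique global solution $(\theta,\rho)\in C^\infty((0,\infty)\times[0,L])\cap C^0([0,\infty);C^2([0,L]))$; for $t>0$ the functions $\partial_s\theta(t,\cdot)$ and $\rho(t,\cdot)$ extend to smooth $L$-periodic functions on $\mathbb{R}$, and $\limsup_{t\to\infty}(\|\theta(t)\|_{W^{3,2}(0,L)}+\|\rho(t)\|_{W^{3,2}(0,L)})<\infty$. *)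

theory Defs
  imports "HOL-Analysis.Analysis"
begin

section \<open>Function spaces\<close>

text \<open>One-sided at boundary points of \<^term>\<open>S\<close>; the ordinary derivative if \<^term>\<open>S = UNIV\<close>.\<close>

definition deriv_within :: "real set \<Rightarrow> (real \<Rightarrow> real) \<Rightarrow> real \<Rightarrow> real" where
  "deriv_within S f x = vector_derivative f (at x within S)"

definition Ck_on :: "nat \<Rightarrow> real set \<Rightarrow> (real \<Rightarrow> real) \<Rightarrow> bool" where
  "Ck_on k S f \<longleftrightarrow>
     (\<forall>j<k. \<forall>x\<in>S. (deriv_within S ^^ j) f differentiable (at x within S)) \<and>
     continuous_on S ((deriv_within S ^^ k) f)"

definition smooth_on :: "real set \<Rightarrow> (real \<Rightarrow> real) \<Rightarrow> bool" where
  "smooth_on S f \<longleftrightarrow> (\<forall>k. Ck_on k S f)"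

text \<open>Functions of time and arc length are curried, \<^term>\<open>f t s\<close>; only the values with
  \<^term>\<open>t \<ge> 0\<close> and \<^term>\<open>s \<in> {0..L}\<close> are ever meaningful.\<close>

definition dt :: "(real \<Rightarrow> real \<Rightarrow> real) \<Rightarrow> real \<Rightarrow> real \<Rightarrow> real" where
  "dt f t s = vector_derivative (\<lambda>\<tau>. f \<tau> s) (at t)"

definition ds :: "real \<Rightarrow> (real \<Rightarrow> real \<Rightarrow> real) \<Rightarrow> real \<Rightarrow> real \<Rightarrow> real" where
  "ds L f t s = deriv_within {0..L} (f t) s"

text \<open>The space \<open>C\<^sup>k((0,\<infinity>) \<times> [0,L])\<close>: all iterated partial derivatives of order at most \<open>k\<close>,
  taken in any order, exist and are jointly continuous up to the lateral boundary.\<close>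

primrec Ck_strip :: "real \<Rightarrow> nat \<Rightarrow> (real \<Rightarrow> real \<Rightarrow> real) \<Rightarrow> bool" where
  "Ck_strip L 0 f \<longleftrightarrow> continuous_on ({0<..} \<times> {0..L}) (\<lambda>(t, s). f t s)"
| "Ck_strip L (Suc k) f \<longleftrightarrow>
     continuous_on ({0<..} \<times> {0..L}) (\<lambda>(t, s). f t s) \<and>
     (\<forall>t>0. \<forall>s\<in>{0..L}. (\<lambda>\<tau>. f \<tau> s) differentiable (at t) \<and>
                         f t differentiable (at s within {0..L})) \<and>
     Ck_strip L k (dt f) \<and> Ck_strip L k (ds L f)"

definition smooth_strip :: "real \<Rightarrow> (real \<Rightarrow> real \<Rightarrow> real) \<Rightarrow> bool" where
  "smooth_strip L f \<longleftrightarrow> (\<forall>k. Ck_strip L k f)"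

text \<open>The space \<open>C\<^sup>0([0,\<infinity>); C\<^sup>2([0,L]))\<close>: continuity with respect to the \<open>C\<^sup>2\<close> norm is uniform
  convergence of the derivatives of order at most two.\<close>

definition C0_C2 :: "real \<Rightarrow> (real \<Rightarrow> real \<Rightarrow> real) \<Rightarrow> bool" where
  "C0_C2 L f \<longleftrightarrow>
     (\<forall>t\<ge>0. Ck_on 2 {0..L} (f t)) \<and>
     (\<forall>t\<ge>0. \<forall>j\<le>2. uniform_limit {0..L} (\<lambda>\<tau>. (deriv_within {0..L} ^^ j) (f \<tau>))
                     ((deriv_within {0..L} ^^ j) (f t)) (at t within {0..}))"

section \<open>The flow\<close>

text \<open>In the multipliers, \<^term>\<open>\<theta>\<close> and \<^term>\<open>\<rho>\<close> are functions of arc length alone, i.e. the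
  time slices of a solution.\<close>

definition Pi_matrix :: "real \<Rightarrow> (real \<Rightarrow> real) \<Rightarrow> real^2^2" where
  "Pi_matrix L \<theta> = vector
     [vector [integral {0..L} (\<lambda>s. (sin (\<theta> s))\<^sup>2), - integral {0..L} (\<lambda>s. cos (\<theta> s) * sin (\<theta> s))],
      vector [- integral {0..L} (\<lambda>s. cos (\<theta> s) * sin (\<theta> s)), integral {0..L} (\<lambda>s. (cos (\<theta> s))\<^sup>2)]]"

definition lambda_theta ::
  "real \<Rightarrow> real \<Rightarrow> (real \<Rightarrow> real) \<Rightarrow> (real \<Rightarrow> real) \<Rightarrow> (real \<Rightarrow> real) \<Rightarrow> real^2" where
  "lambda_theta L c0 \<beta> \<theta> \<rho> =
     matrix_inv (Pi_matrix L \<theta>) *v vector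
       [integral {0..L} (\<lambda>s. cos (\<theta> s) * deriv_within {0..L} \<theta> s * \<beta> (\<rho> s) * (deriv_within {0..L} \<theta> s - c0)),
        integral {0..L} (\<lambda>s. sin (\<theta> s) * deriv_within {0..L} \<theta> s * \<beta> (\<rho> s) * (deriv_within {0..L} \<theta> s - c0))]"

definition lambda_rho ::
  "real \<Rightarrow> real \<Rightarrow> (real \<Rightarrow> real) \<Rightarrow> (real \<Rightarrow> real) \<Rightarrow> (real \<Rightarrow> real) \<Rightarrow> real" where
  "lambda_rho L c0 \<beta> \<theta> \<rho> =
     - 1 / (2 * L) * integral {0..L} (\<lambda>s. deriv \<beta> (\<rho> s) * (deriv_within {0..L} \<theta> s - c0)\<^sup>2)"

definition admissible_datum ::
  "real \<Rightarrow> real \<Rightarrow> int \<Rightarrow> (real \<Rightarrow> real) \<Rightarrow> (real \<Rightarrow> real) \<Rightarrow> bool" where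
  "admissible_datum L \<nu> \<omega> \<theta>0 \<rho>0 \<longleftrightarrow>
     smooth_on {0..L} \<theta>0 \<and> smooth_on {0..L} \<rho>0 \<and>
     integral {0..L} \<rho>0 = \<nu> * L \<and>
     integral {0..L} (\<lambda>s. sin (\<theta>0 s)) = 0 \<and> integral {0..L} (\<lambda>s. cos (\<theta>0 s)) = 0 \<and>
     \<theta>0 L - \<theta>0 0 = 2 * pi * of_int \<omega> \<and> \<rho>0 L = \<rho>0 0 \<and>
     (\<forall>j\<in>{1, 2}. (deriv_within {0..L} ^^ j) \<theta>0 L = (deriv_within {0..L} ^^ j) \<theta>0 0 \<and>
                 (deriv_within {0..L} ^^ j) \<rho>0 L = (deriv_within {0..L} ^^ j) \<rho>0 0)"

text \<open>Global solutions in the class in which existence and uniqueness hold. Invertibility of the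
  matrix is required explicitly because \<^const>\<open>matrix_inv\<close> is unspecified on singular matrices.\<close>

definition global_solution ::
  "real \<Rightarrow> real \<Rightarrow> int \<Rightarrow> real \<Rightarrow> (real \<Rightarrow> real) \<Rightarrow> (real \<Rightarrow> real) \<Rightarrow> (real \<Rightarrow> real) \<Rightarrow>
   (real \<Rightarrow> real \<Rightarrow> real) \<Rightarrow> (real \<Rightarrow> real \<Rightarrow> real) \<Rightarrow> bool" where
  "global_solution L \<mu> \<omega> c0 \<beta> \<theta>0 \<rho>0 \<theta> \<rho> \<longleftrightarrow>
     smooth_strip L \<theta> \<and> C0_C2 L \<theta> \<and> smooth_strip L \<rho> \<and> C0_C2 L \<rho> \<and>
     (\<forall>t>0. invertible (Pi_matrix L (\<theta> t))) \<and>
     (\<forall>t>0. \<forall>s\<in>{0..L}.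
        dt \<theta> t s = ds L (\<lambda>\<tau> x. \<beta> (\<rho> \<tau> x) * (ds L \<theta> \<tau> x - c0)) t s
          + lambda_theta L c0 \<beta> (\<theta> t) (\<rho> t) $ 1 * sin (\<theta> t s)
          - lambda_theta L c0 \<beta> (\<theta> t) (\<rho> t) $ 2 * cos (\<theta> t s)) \<and>
     (\<forall>t>0. \<forall>s\<in>{0..L}.
        dt \<rho> t s = \<mu> * ds L (ds L \<rho>) t s - 1 / 2 * deriv \<beta> (\<rho> t s) * (ds L \<theta> t s - c0)\<^sup>2
          - lambda_rho L c0 \<beta> (\<theta> t) (\<rho> t)) \<and>
     (\<forall>t>0. \<theta> t L - \<theta> t 0 = 2 * pi * of_int \<omega> \<and> \<rho> t L = \<rho> t 0 \<and>
            ds L \<theta> t L = ds L \<theta> t 0 \<and> ds L \<rho> t L = ds L \<rho> t 0) \<and>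
     (\<forall>s\<in>{0..L}. \<theta> 0 s = \<theta>0 s \<and> \<rho> 0 s = \<rho>0 s)"

end

theory Submission
  imports Defs
begin

text \<open>The minimum principle applied to the barrier \<open>x0 - \<epsilon> exp (C t)\<close>: where the density first
  touches it, with depth \<open>m = \<epsilon> exp (C t)\<close> below \<open>x0\<close>, the Lipschitz bound
  \<open>\<bar>\<beta>' x\<bar> \<le> K (x0 - x)\<close> controls the local reaction term by \<open>- K A m / 2\<close>, where \<open>A\<close> bounds
  \<open>(\<partial>\<^sub>s \<theta> - c0)\<^sup>2\<close>. The nonlocal term obeys the same bound since \<open>\<beta>' \<ge> 0\<close> above \<open>x0\<close>.
  Hence \<open>\<partial>\<^sub>t \<rho> \<ge> - K A m\<close> there, which contradicts \<open>\<partial>\<^sub>t \<rho> \<le> - C m\<close> as soon as \<open>C > K A\<close>.\<close>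

section \<open>Regularity of the coefficient and of the solution\<close>

lemma has_real_derivative_deriv_within:
  assumes "f differentiable (at x within {a..b})" "a < b" "x \<in> {a..b}"
  shows "(f has_real_derivative deriv_within {a..b} f x) (at x within {a..b})"
  using assms unfolding deriv_within_def
  by (metis has_real_derivative_iff_has_vector_derivative vector_derivative_works)

lemma has_real_derivative_deriv_within_UNIV:
  assumes "f differentiable (at x)"
  shows "(f has_real_derivative deriv_within UNIV f x) (at x)"
  using assms unfolding deriv_within_def
  by (metis has_real_derivative_iff_has_vector_derivative vector_derivative_works)

lemma deriv_within_UNIV: "deriv_within UNIV f = deriv f" if "\<And>x. f differentiable (at x)"
  using DERIV_imp_deriv[OF has_real_derivative_deriv_within_UNIV[OF that]] by auto

text \<open>Translates the iterated \<open>deriv_within UNIV\<close> of \<open>Ck_on\<close> into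
  \<open>deriv\<close>, the form in which \<beta> is differentiated in the flow and in
  \<open>lambda_rho\<close>.\<close>

lemma smooth_on_UNIV_C2:
  assumes "smooth_on UNIV f"
  shows "(deriv f has_real_derivative deriv (deriv f) x) (at x)"
    and "continuous_on UNIV (deriv (deriv f))"
proof -
  have C: "Ck_on 2 UNIV f" using assms by (simp add: smooth_on_def)
  have d: "(deriv_within UNIV ^^ j) f differentiable (at x)" if "j < 2" for j x
    using C that by (auto simp: Ck_on_def)
  have 1: "deriv_within UNIV f = deriv f"
    using d[of 0] by (intro deriv_within_UNIV) simp
  have e: "deriv f differentiable (at x)" for x
    using d[of 1] by (simp add: 1)
  have 2: "deriv_within UNIV (deriv f) = deriv (deriv f)"
    using e by (rule deriv_within_UNIV)
  show "(deriv f has_real_derivative deriv (deriv f) x) (at x)"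
    using has_real_derivative_deriv_within_UNIV[OF e] by (simp add: 2)
  have "continuous_on UNIV ((deriv_within UNIV ^^ 2) f)" using C by (simp add: Ck_on_def)
  then show "continuous_on UNIV (deriv (deriv f))" by (simp add: numeral_2_eq_2 1 2)
qed

text \<open>Mean value estimate with a bound for \<open>f'\<close> on the compact interval. It is
  anchored at \<open>b\<close> because, for \<open>f = deriv \<beta>\<close> and
  \<open>b = x0\<close>, the value \<open>f b\<close> vanishes and the bound is proportional to the
  depth below \<open>x0\<close>.\<close>

lemma C1_Lipschitz_at_right_endpoint:
  fixes f f' :: "real \<Rightarrow> real"
  assumes "\<And>x. (f has_real_derivative f' x) (at x)" "continuous_on UNIV f'"
  obtains K where "K \<ge> 0" "\<And>x. x \<in> {a..b} \<Longrightarrow> \<bar>f x - f b\<bar> \<le> K * (b - x)"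
proof -
  have "bounded (f' ` {a..b})"
    by (intro compact_imp_bounded compact_continuous_image continuous_on_subset[OF assms(2)]) auto
  then obtain K where K: "K > 0" "\<And>x. x \<in> {a..b} \<Longrightarrow> \<bar>f' x\<bar> \<le> K"
    by (auto simp: bounded_pos)
  have "\<bar>f x - f b\<bar> \<le> K * (b - x)" if "x \<in> {a..b}" for x
  proof -
    have "norm (f x - f b) \<le> K * norm (x - b)"
      by (rule field_differentiable_bound[of "{a..b}" f f'])
        (use assms(1) K that in \<open>auto intro: has_field_derivative_at_within\<close>)
    then show ?thesis using that by simp
  qed
  with K(1) show ?thesis using that[of K] by simp
qed

text \<open>An e/2 argument through the intermediate point \<open>(t, x)\<close>: uniform
  convergence handles the change of time, continuity of the slice the change of arc length. The
  closed time axis matters: \<open>smooth_strip\<close> gives no control at time 0.\<close>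

lemma C0_C2_continuous_on:
  assumes "C0_C2 L f" "j \<le> 1"
  shows "continuous_on ({0..} \<times> {0..L}) (\<lambda>(t, s). (deriv_within {0..L} ^^ j) (f t) s)"
    (is "continuous_on _ (\<lambda>(t, s). ?g t s)")
proof -
  have c: "continuous_on {0..L} (?g t)" if "t \<ge> 0" for t
  proof -
    have "Ck_on 2 {0..L} (f t)" using assms that by (simp add: C0_C2_def)
    then show ?thesis using assms(2)
      by (auto simp: Ck_on_def continuous_on_eq_continuous_within
          intro!: differentiable_imp_continuous_within)
  qed
  have u: "uniform_limit {0..L} ?g (?g t) (at t within {0..})" if "t \<ge> 0" for t
    using assms that by (simp add: C0_C2_def)
  show ?thesis unfolding continuous_on_iff
  proof (clarsimp, goal_cases)
    case (1 t s e)
    from uniform_limitD[OF u[OF 1(1)], of "e/2"] \<open>e > 0\<close>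
    obtain d1 where d1: "d1 > 0"
      "\<And>\<tau> x. \<tau> \<ge> 0 \<Longrightarrow> \<tau> \<noteq> t \<Longrightarrow> dist \<tau> t < d1 \<Longrightarrow> x \<in> {0..L} \<Longrightarrow> dist (?g \<tau> x) (?g t x) < e/2"
      unfolding eventually_at by auto
    from c[OF 1(1)] obtain d2 where d2: "d2 > 0"
      "\<And>x. x \<in> {0..L} \<Longrightarrow> dist x s < d2 \<Longrightarrow> dist (?g t x) (?g t s) < e/2"
      using 1 unfolding continuous_on_iff by (metis atLeastAtMost_iff half_gt_zero)
    have "dist (?g \<tau> x) (?g t s) < e"
      if "\<tau> \<ge> 0" "x \<in> {0..L}" "dist (\<tau>, x) (t, s) < min d1 d2" for \<tau> x
    proof -
      have "dist \<tau> t < d1" "dist x s < d2"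
        using that(3) dist_fst_le[of "(\<tau>, x)" "(t, s)"] dist_snd_le[of "(\<tau>, x)" "(t, s)"] by auto
      then have "dist (?g \<tau> x) (?g t x) < e/2" "dist (?g t x) (?g t s) < e/2"
        using d1(2)[of \<tau> x] d2(2)[of x] that \<open>e > 0\<close> by (cases "\<tau> = t"; auto)+
      then show ?thesis using dist_triangle[of "?g \<tau> x" "?g t s" "?g t x"] by linarith
    qed
    then show ?case using d1(1) d2(1)
      by (intro exI[of _ "min d1 d2"]) auto
  qed
qed

section \<open>Minimum conditions on an interval\<close>

text \<open>If \<open>d < 0\<close>, then \<open>f'\<close> is negative just to the right of
  \<open>s\<close>, and the mean value theorem pushes \<open>f\<close> below its minimum. Only
  points to the right are used, so \<open>s = a\<close> is allowed; there \<open>f' s = 0\<close>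
  does not follow from minimality and has to be assumed.\<close>

lemma second_derivative_nonneg_at_minimum:
  fixes f f' :: "real \<Rightarrow> real"
  assumes f: "\<And>x. x \<in> {a..b} \<Longrightarrow> (f has_real_derivative f' x) (at x within {a..b})"
    and f': "(f' has_real_derivative d) (at s within {a..b})"
    and s: "a \<le> s" "s < b" "f' s = 0"
    and min: "\<And>x. x \<in> {a..b} \<Longrightarrow> f s \<le> f x"
  shows "d \<ge> 0"
proof (rule ccontr)
  assume "\<not> d \<ge> 0"
  then obtain e where e: "e > 0" "\<And>h. 0 < h \<Longrightarrow> s + h \<in> {a..b} \<Longrightarrow> h < e \<Longrightarrow> f' s > f' (s + h)"
    using has_real_derivative_neg_dec_right[OF f'] by auto
  define y where "y = min b (s + e / 2)"
  have y: "s < y" "y \<le> b" "y < s + e" using e(1) s by (auto simp: y_def)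
  have "\<exists>x>s. x < y \<and> f y - f s = (\<lambda>h. h * f' x) (y - s)"
  proof (rule mvt[OF y(1)])
    show "continuous_on {s..y} f"
      using DERIV_continuous_on[OF f] y s by (rule_tac continuous_on_subset[of "{a..b}"]) auto
    show "(f has_derivative (\<lambda>h. h * f' x)) (at x)" if "s < x" "x < y" for x
      using f[of x] that y s at_within_interior[of x "{a..b}"]
      by (auto simp: has_field_derivative_def mult_commute_abs)
  qed blast
  then obtain x where x: "s < x" "x < y" "f y - f s = (y - s) * f' x" by auto
  have "f' x < 0" using e(2)[of "x - s"] x y s by auto
  then have "f y < f s" using x y mult_pos_neg[of "y - s" "f' x"] by auto
  then show False using min[of y] y s by auto
qed

text \<open>Each sign comes from difference quotients on one side, so an endpoint retains one of the
  two. The second is applied in time as well, at the right end of \<open>{0..t}\<close>.\<close>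

lemma derivative_sign_at_minimum:
  fixes f :: "real \<Rightarrow> real"
  assumes f: "(f has_real_derivative d) (at s within {a..b})"
    and min: "\<And>x. x \<in> {a..b} \<Longrightarrow> f s \<le> f x"
  shows "a \<le> s \<Longrightarrow> s < b \<Longrightarrow> d \<ge> 0" and "a < s \<Longrightarrow> s \<le> b \<Longrightarrow> d \<le> 0"
proof -
  assume s: "a \<le> s" "s < b"
  show "d \<ge> 0"
  proof (rule ccontr)
    assume "\<not> d \<ge> 0"
    then obtain e where e: "e > 0" "\<And>h. 0 < h \<Longrightarrow> s + h \<in> {a..b} \<Longrightarrow> h < e \<Longrightarrow> f s > f (s + h)"
      using has_real_derivative_neg_dec_right[OF f] by auto
    obtain h where h: "0 < h" "h < e" "h \<le> b - s"
      using e(1) s that[of "min (b - s) (e/2)"] by auto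
    then show False
      using e(2)[of h] min[of "s + h"] s h by auto
  qed
next
  assume s: "a < s" "s \<le> b"
  show "d \<le> 0"
  proof (rule ccontr)
    assume "\<not> d \<le> 0"
    then obtain e where e: "e > 0" "\<And>h. 0 < h \<Longrightarrow> s - h \<in> {a..b} \<Longrightarrow> h < e \<Longrightarrow> f s > f (s - h)"
      using has_real_derivative_pos_inc_left[OF f] by auto
    obtain h where h: "0 < h" "h < e" "h \<le> s - a"
      using e(1) s that[of "min (s - a) (e/2)"] by auto
    then show False
      using e(2)[of h] min[of "s - h"] s h by auto
  qed
qed

text \<open>In the interior both one-sided signs force \<open>f' s = 0\<close>. If
  \<open>s = a\<close>, periodicity makes \<open>b\<close> a minimum too; the left-sided sign at
  \<open>b\<close> carries over to \<open>a\<close> through \<open>f' a = f' b\<close>.\<close>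

lemma periodic_second_derivative_nonneg_at_minimum:
  fixes f f' :: "real \<Rightarrow> real"
  assumes f: "\<And>x. x \<in> {a..b} \<Longrightarrow> (f has_real_derivative f' x) (at x within {a..b})"
    and f': "(f' has_real_derivative d) (at s within {a..b})"
    and s: "a \<le> s" "s < b" and per: "f a = f b" "f' a = f' b"
    and min: "\<And>x. x \<in> {a..b} \<Longrightarrow> f s \<le> f x"
  shows "d \<ge> 0"
proof (rule second_derivative_nonneg_at_minimum[OF f f' s _ min])
  have "f' s \<ge> 0"
    using derivative_sign_at_minimum(1)[OF f[of s] min] s by auto
  moreover have "f' s \<le> 0"
  proof (cases "s = a")
    case True
    then show ?thesis
      using derivative_sign_at_minimum(2)[OF f[of b]] min per s by fastforce
  next
    case False
    then show ?thesis
      using derivative_sign_at_minimum(2)[OF f[of s] min] s by auto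
  qed
  ultimately show "f' s = 0" by simp
qed auto

section \<open>Ingredients of the barrier argument\<close>

lemma continuous_on_slices:
  assumes "continuous_on (A \<times> B) (\<lambda>(t, s). g t s)"
  shows "t \<in> A \<Longrightarrow> continuous_on B (g t)" and "s \<in> B \<Longrightarrow> continuous_on A (\<lambda>t. g t s)"
proof -
  assume "t \<in> A"
  then have "continuous_on B (\<lambda>s. (\<lambda>(t, s). g t s) (t, s))"
    by (intro continuous_on_compose2[OF assms] continuous_intros) auto
  then show "continuous_on B (g t)" by simp
next
  assume "s \<in> B"
  then have "continuous_on A (\<lambda>t. (\<lambda>(t, s). g t s) (t, s))"
    by (intro continuous_on_compose2[OF assms] continuous_intros) auto
  then show "continuous_on A (\<lambda>t. g t s)" by simp
qed

text \<open>The points with \<open>g \<le> 0\<close> form a nonempty compact set, on which the time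
  coordinate attains its minimum \<open>t\<close>. Positivity before \<open>t\<close> passes to the
  limit as \<open>g t x \<ge> 0\<close>, which turns \<open>g t s \<le> 0\<close> into
  equality.\<close>

lemma first_touching_point:
  fixes g :: "real \<Rightarrow> real \<Rightarrow> real"
  assumes g: "continuous_on ({0..T} \<times> {0..L}) (\<lambda>(t, s). g t s)"
    and init: "\<And>s. s \<in> {0..L} \<Longrightarrow> g 0 s > 0"
    and neg: "0 \<le> T" "s' \<in> {0..L}" "g T s' \<le> 0"
  obtains t s where "0 < t" "t \<le> T" "s \<in> {0..L}" "g t s = 0"
    "\<And>x. x \<in> {0..L} \<Longrightarrow> g t x \<ge> 0" "\<And>\<tau> x. 0 \<le> \<tau> \<Longrightarrow> \<tau> < t \<Longrightarrow> x \<in> {0..L} \<Longrightarrow> g \<tau> x > 0"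
proof -
  define S where "S = {p \<in> {0..T} \<times> {0..L}. (\<lambda>(t, s). g t s) p \<le> 0}"
  have "closed S" unfolding S_def
    by (rule continuous_on_closed_Collect_le[OF g continuous_on_const]) (simp add: closed_Times)
  moreover have "bounded S"
    by (rule bounded_subset[of "{0..T} \<times> {0..L}"]) (auto simp: S_def intro!: bounded_Times)
  ultimately have "compact S" by (simp add: compact_eq_bounded_closed)
  moreover have "S \<noteq> {}" using neg by (auto simp: S_def)
  ultimately obtain p where p: "p \<in> S" "\<And>q. q \<in> S \<Longrightarrow> fst p \<le> fst q"
    using continuous_attains_inf[of S fst] continuous_on_fst[OF continuous_on_id] by blast
  obtain t s where ts: "p = (t, s)" by force
  have t: "0 \<le> t" "t \<le> T" "s \<in> {0..L}" "g t s \<le> 0" using p ts by (auto simp: S_def)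
  have pos: "g \<tau> x > 0" if "0 \<le> \<tau>" "\<tau> < t" "x \<in> {0..L}" for \<tau> x
    using p(2)[of "(\<tau>, x)"] that ts t by (force simp: S_def)
  have "t \<noteq> 0" using init[of s] t by auto
  then have t0: "t > 0" using t by auto
  have nn: "g t x \<ge> 0" if x: "x \<in> {0..L}" for x
  proof -
    have "continuous_on {0..T} (\<lambda>\<tau>. g \<tau> x)"
      using continuous_on_slices(2)[OF g] x by simp
    then have "continuous_on {0..t} (\<lambda>\<tau>. g \<tau> x)"
      by (rule continuous_on_subset) (use t in auto)
    then have "((\<lambda>\<tau>. g \<tau> x) \<longlongrightarrow> g t x) (at t within {0..t})"
      using t by (auto simp: continuous_on_def)
    then have "((\<lambda>\<tau>. g \<tau> x) \<longlongrightarrow> g t x) (at_left t)"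
      using t0 by (simp add: at_within_Icc_at_left)
    moreover have "\<forall>\<^sub>F \<tau> in at_left t. g \<tau> x \<ge> 0"
      using eventually_at_left_real[OF t0]
      by eventually_elim (use pos x in \<open>auto intro: less_imp_le\<close>)
    ultimately show ?thesis by (intro tendsto_lowerbound) auto
  qed
  show ?thesis
    using that[of t s] t t0 nn pos by (metis antisym)
qed

text \<open>The local and the nonlocal term each cost at most \<open>K * A * m / 2\<close>, and
  diffusion has a good sign. The values of \<open>r\<close> may exceed \<open>x0\<close>, beyond the
  reach of \<open>lip\<close>; there the sign of \<open>deriv \<beta>\<close> gives the lower
  bound.\<close>

lemma reaction_lower_bound_at_minimum:
  fixes L \<mu> c0 x0 C K A m :: real
  assumes L: "L > 0" and mu: "\<mu> > 0" and m: "m > 0" and K: "K \<ge> 0"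
    and pos: "\<And>x. x \<ge> x0 \<Longrightarrow> deriv \<beta> x \<ge> 0"
    and lip: "\<And>x. x \<in> {x0 - m..x0} \<Longrightarrow> \<bar>deriv \<beta> x\<bar> \<le> K * (x0 - x)"
    and r: "\<And>x. x \<in> {0..L} \<Longrightarrow> r x \<ge> x0 - m" and s: "s \<in> {0..L}" "r s = x0 - m"
    and A: "\<And>x. x \<in> {0..L} \<Longrightarrow> (deriv_within {0..L} \<theta> x - c0)\<^sup>2 \<le> A"
    and int: "(\<lambda>x. deriv \<beta> (r x) * (deriv_within {0..L} \<theta> x - c0)\<^sup>2) integrable_on {0..L}"
    and rss: "rss \<ge> 0"
  shows "\<mu> * rss - 1 / 2 * deriv \<beta> (r s) * (deriv_within {0..L} \<theta> s - c0)\<^sup>2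
          - lambda_rho L c0 \<beta> \<theta> r \<ge> - (K * A * m)"
proof -
  let ?q = "\<lambda>x. (deriv_within {0..L} \<theta> x - c0)\<^sup>2"
  have lower: "deriv \<beta> (r x) * ?q x \<ge> - (K * m * A)" if x: "x \<in> {0..L}" for x
  proof -
    have "deriv \<beta> (r x) \<ge> - (K * m)"
    proof (cases "r x \<ge> x0")
      case True
      then show ?thesis using pos[of "r x"] K m by (smt (verit) mult_nonneg_nonneg)
    next
      case False
      then have "\<bar>deriv \<beta> (r x)\<bar> \<le> K * (x0 - r x)" using lip r[OF x] by auto
      also have "\<dots> \<le> K * m" using r[OF x] K by (intro mult_left_mono) auto
      finally show ?thesis by simp
    qed
    then have "- (K * m) * ?q x \<le> deriv \<beta> (r x) * ?q x" by (intro mult_right_mono) auto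
    moreover have "K * m * ?q x \<le> K * m * A" using A[OF x] K m by (intro mult_left_mono) auto
    ultimately show ?thesis by simp
  qed
  have "integral {0..L} (\<lambda>x. - (K * m * A)) \<le> integral {0..L} (\<lambda>x. deriv \<beta> (r x) * ?q x)"
    using lower int by (intro integral_le) auto
  \<comment> \<open>The length of the interval cancels the factor \<open>1 / L\<close> of
    \<open>lambda_rho\<close>, leaving half of the pointwise bound.\<close>
  then have "- lambda_rho L c0 \<beta> \<theta> r \<ge> - (K * m * A) / 2"
    using L by (simp add: lambda_rho_def field_simps)
  moreover have "deriv \<beta> (r s) * ?q s \<le> K * m * A"
  proof -
    have "deriv \<beta> (r s) * ?q s \<le> (K * m) * ?q s"
      using lip[of "r s"] s m by (intro mult_right_mono) auto
    also have "\<dots> \<le> K * m * A" using A[OF s(1)] K m by (intro mult_left_mono) auto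
    finally show ?thesis .
  qed
  moreover have "\<mu> * rss \<ge> 0" using mu rss by simp
  ultimately show ?thesis by (simp add: algebra_simps)
qed

section \<open>Contradiction at the first contact with the barrier\<close>

theorem proposition3p8:
  fixes L \<nu> \<mu> c0 x0 :: real and \<omega> :: int
    and \<beta> \<theta>0 \<rho>0 :: "real \<Rightarrow> real" and \<theta> \<rho> :: "real \<Rightarrow> real \<Rightarrow> real"
  assumes "L > 0" and "\<mu> > 0"
    and "smooth_on UNIV \<beta>" and "\<And>x. \<beta> x > 0"
    and "\<And>x. x \<ge> x0 \<Longrightarrow> deriv \<beta> x \<ge> 0" and "deriv \<beta> x0 = 0"
    and "admissible_datum L \<nu> \<omega> \<theta>0 \<rho>0"
    and "global_solution L \<mu> \<omega> c0 \<beta> \<theta>0 \<rho>0 \<theta> \<rho>"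
    and "\<And>s. s \<in> {0..L} \<Longrightarrow> \<rho>0 s \<ge> x0"
  shows "\<forall>t>0. \<forall>s\<in>{0..L}. \<rho> t s \<ge> x0"
proof (rule ccontr)
  note L = \<open>L > 0\<close>
  note sol = assms(8)[unfolded global_solution_def]
  assume "\<not> ?thesis"
  then obtain T s' where T: "T > 0" "s' \<in> {0..L}" "\<rho> T s' < x0" by (auto simp: not_le)
  define Q where "Q = {0..T} \<times> {0..L}"
  have Q: "compact Q" "Q \<subseteq> {0..} \<times> {0..L}" by (auto simp: Q_def intro: compact_Times)
  have c\<rho>: "continuous_on ({0..} \<times> {0..L}) (\<lambda>(t, s). \<rho> t s)"
    using C0_C2_continuous_on[of L \<rho> 0] sol by auto
  have c\<theta>: "continuous_on ({0..} \<times> {0..L}) (\<lambda>(t, s). deriv_within {0..L} (\<theta> t) s)"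
    using C0_C2_continuous_on[of L \<theta> 1] sol by auto
  have "bounded ((\<lambda>p. ((\<lambda>(t, s). deriv_within {0..L} (\<theta> t) s) p - c0)\<^sup>2) ` Q)"
    using continuous_on_subset[OF c\<theta> Q(2)] Q(1)
    by (intro compact_imp_bounded compact_continuous_image continuous_intros)
  then obtain A
    where A: "\<And>t s. t \<in> {0..T} \<Longrightarrow> s \<in> {0..L} \<Longrightarrow> (deriv_within {0..L} (\<theta> t) s - c0)\<^sup>2 \<le> A"
    by (force simp: bounded_pos Q_def)
  have "bounded ((\<lambda>p. (\<lambda>(t, s). \<rho> t s) p - x0) ` Q)"
    using continuous_on_subset[OF c\<rho> Q(2)] Q(1)
    by (intro compact_imp_bounded compact_continuous_image continuous_intros)
  then obtain R where R: "\<And>t s. t \<in> {0..T} \<Longrightarrow> s \<in> {0..L} \<Longrightarrow> \<bar>\<rho> t s - x0\<bar> \<le> R"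
    by (force simp: bounded_pos Q_def)
  \<comment> \<open>\<open>K\<close> must be known before the barrier is chosen, so it is taken on
    an interval whose depth \<open>R\<close> bounds every dip of \<rho> up to time
    \<open>T\<close>.\<close>
  obtain K where K: "K \<ge> 0" "\<And>x. x \<in> {x0 - R..x0} \<Longrightarrow> \<bar>deriv \<beta> x\<bar> \<le> K * (x0 - x)"
    using C1_Lipschitz_at_right_endpoint[of "deriv \<beta>" "deriv (deriv \<beta>)" "x0 - R" x0]
      smooth_on_UNIV_C2[OF assms(3)] assms(6) by auto
  \<comment> \<open>The summand 1 makes the final inequality strict.\<close>
  define C where "C = K * A + 1"
  \<comment> \<open>Chosen so that the barrier meets \<rho> at \<open>(T, s')\<close>, which forces
    a first contact no later than \<open>T\<close>. No smallness of \<open>e\<close> is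
    required.\<close>
  define e where "e = (x0 - \<rho> T s') / exp (C * T)"
  have e: "e > 0" using T by (simp add: e_def)
  define g where "g t s = \<rho> t s - x0 + e * exp (C * t)" for t s
  have "continuous_on Q (\<lambda>p. (\<lambda>(t, s). \<rho> t s) p - x0 + e * exp (C * fst p))"
    by (intro continuous_intros continuous_on_subset[OF c\<rho> Q(2)])
  then have "continuous_on ({0..T} \<times> {0..L}) (\<lambda>(t, s). g t s)"
    by (simp add: Q_def g_def case_prod_unfold)
  moreover have "g 0 s > 0" if "s \<in> {0..L}" for s
  proof -
    have "\<rho> 0 s = \<rho>0 s" using sol that by blast
    then show ?thesis using assms(9)[OF that] e by (simp add: g_def)
  qed
  moreover have "g T s' \<le> 0" by (simp add: g_def e_def)
  ultimately obtain t s1 where t: "0 < t" "t \<le> T" and s1: "s1 \<in> {0..L}" "g t s1 = 0"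
    and nn: "\<And>x. x \<in> {0..L} \<Longrightarrow> g t x \<ge> 0"
    and before: "\<And>\<tau> x. 0 \<le> \<tau> \<Longrightarrow> \<tau> < t \<Longrightarrow> x \<in> {0..L} \<Longrightarrow> g \<tau> x > 0"
    using first_touching_point[of T L g s'] T by (metis less_imp_le)
  define m where "m = e * exp (C * t)"
  have m: "m > 0" "\<rho> t s1 = x0 - m" "\<And>x. x \<in> {0..L} \<Longrightarrow> \<rho> t x \<ge> x0 - m"
    using e s1 nn by (auto simp: m_def g_def field_simps)
  \<comment> \<open>Hence the Lipschitz bound for \<open>deriv \<beta>\<close> is available on all
    of \<open>{x0 - m..x0}\<close>.\<close>
  have "m \<le> R" using R[of t s1] t s1 m by auto

  have per: "\<rho> t 0 = \<rho> t L" "ds L \<rho> t 0 = ds L \<rho> t L" using sol t by auto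
  have strip: "Ck_strip L 2 \<rho>" using sol by (simp add: smooth_strip_def)
  have d\<rho>: "(\<rho> t has_real_derivative ds L \<rho> t x) (at x within {0..L})" if "x \<in> {0..L}" for x
    unfolding ds_def using strip t L that
    by (intro has_real_derivative_deriv_within) (auto simp: numeral_2_eq_2)
  have dd\<rho>: "(ds L \<rho> t has_real_derivative ds L (ds L \<rho>) t x) (at x within {0..L})"
    if "x \<in> {0..L}" for x
    unfolding ds_def[of L "ds L \<rho>"] using strip t L that
    by (intro has_real_derivative_deriv_within) (auto simp: numeral_2_eq_2)
  have dt\<rho>: "((\<lambda>\<tau>. \<rho> \<tau> x) has_real_derivative dt \<rho> t x) (at t)" if "x \<in> {0..L}" for x
  proof -
    have "(\<lambda>\<tau>. \<rho> \<tau> x) differentiable (at t)" using strip t that by (auto simp: numeral_2_eq_2)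
    then show ?thesis unfolding dt_def
      by (metis has_real_derivative_iff_has_vector_derivative vector_derivative_works)
  qed
  \<comment> \<open>Periodicity moves a touching point at \<open>L\<close> to \<open>0\<close>, so a right-sided argument suffices.\<close>
  define s where "s = (if s1 = L then 0 else s1)"
  have s: "0 \<le> s" "s < L" "\<rho> t s = x0 - m" using s1 m(2) per L by (auto simp: s_def)
  then have sL: "s \<in> {0..L}" by simp
  have "ds L (ds L \<rho>) t s \<ge> 0"
    by (rule periodic_second_derivative_nonneg_at_minimum[OF d\<rho> dd\<rho>[OF sL] s(1,2) per])
      (use m s in auto)
  moreover have "(\<lambda>x. deriv \<beta> (\<rho> t x) * (deriv_within {0..L} (\<theta> t) x - c0)\<^sup>2) integrable_on {0..L}"
  proof -
    have "continuous_on {0..L} (\<rho> t)"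
      using t continuous_on_slices(1)[OF c\<rho>] by auto
    moreover have "continuous_on UNIV (deriv \<beta>)"
      using smooth_on_UNIV_C2(1)[OF assms(3)] by (auto intro: DERIV_continuous_on)
    ultimately have "continuous_on {0..L} (\<lambda>x. deriv \<beta> (\<rho> t x))"
      by (auto intro: continuous_on_compose2[of UNIV "deriv \<beta>"])
    moreover have "continuous_on {0..L} (deriv_within {0..L} (\<theta> t))"
      using t continuous_on_slices(1)[OF c\<theta>] by auto
    ultimately show ?thesis
      by (intro integrable_continuous_real continuous_on_mult continuous_on_power
          continuous_on_diff continuous_on_const)
  qed
  ultimately have "\<mu> * ds L (ds L \<rho>) t s
      - 1 / 2 * deriv \<beta> (\<rho> t s) * (deriv_within {0..L} (\<theta> t) s - c0)\<^sup>2
      - lambda_rho L c0 \<beta> (\<theta> t) (\<rho> t) \<ge> - (K * A * m)"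
    using L assms(2,5) m K \<open>m \<le> R\<close> s sL A t
    by (intro reaction_lower_bound_at_minimum) auto
  then have low: "dt \<rho> t s \<ge> - (K * A * m)"
    using sol t sL by (simp add: ds_def[of L \<theta>])
  have dg: "((\<lambda>\<tau>. g \<tau> s) has_real_derivative dt \<rho> t s + C * m) (at t)"
    unfolding g_def m_def using dt\<rho>[OF sL] by (auto intro!: derivative_eq_intros)
  \<comment> \<open>At fixed \<open>s\<close>, the function \<open>g\<close> is positive before
    \<open>t\<close> and zero at \<open>t\<close>, so its minimum over \<open>{0..t}\<close> lies at
    the right end.\<close>
  have "dt \<rho> t s + C * m \<le> 0"
  proof (rule derivative_sign_at_minimum(2))
    show "((\<lambda>\<tau>. g \<tau> s) has_real_derivative dt \<rho> t s + C * m) (at t within {0..t})"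
      using dg by (rule has_field_derivative_at_within)
    have "g t s = 0" using s by (simp add: g_def m_def)
    then show "g t s \<le> g \<tau> s" if "\<tau> \<in> {0..t}" for \<tau>
      using before[of \<tau> s] sL that by (cases "\<tau> = t") auto
  qed (use t in auto)
  \<comment> \<open>The lower bound makes the time derivative of \<open>g\<close> at least
    \<open>(C - K * A) * m = m > 0\<close>.\<close>
  with low m(1) show False by (simp add: C_def algebra_simps)
qed

end
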